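(* Fix $q>1$, let $\mathbb{T}=\{q^k:k\in\mathbb{N}_0\}$ and let $r\in\mathbb{N}$ ($r\ge1$). Let $a,b\in\mathbb{T}$ be such that $[a,b]=\{t\in\mathbb{T}:a\le t\le b\}$ contains at least $2r+1$ points. Consider the variational problem $$\mathcal{L}[y(\cdot)]=\int_{\sigma^{r-1}(a)}^{b}L\bigl(t,y^{\rho^r}(t),y^{\rho^{r-1}\nabla}(t),\ldots,y^{\rho\nabla^{r-1}}(t),y^{\nabla^r}(t)\bigr)\nabla t\longrightarrow\mathrm{extr},$$ $$y^{\nabla^i}(\sigma^{r-1}(a))=\alpha_i,\qquad y^{\nabla^i}(b)=\beta_i,\qquad i=0,1,\ldots,r-1,$$ over $y\in C^{2r}([a,b],\mathbb{R})$, where $\alpha_i,\beta_i\in\mathbb{R}$ are given and the Lagrangian $L(t,u_0,u_1,\ldots,u_r)$ has (standard) continuous partial derivatives with respect to $u_0,\ldots,u_r$, and partial nabla derivative with respect to $t$ of order $r+1$. If $y_\ast$ is a weak local extremum (weak local minimizer or weak local maximizer) of this problem, then $$\sum_{i=0}^{r}(-1)^i q^{\frac{i(i-1)}{2}}L_{u_i}^{\nabla^i}\bigl(t,\,y_\ast(q^{-r}t),\,q^{1-r}y_\ast^{\nabla}(q^{1-r}t),\,\ldots,\,q^{1-r}y_\ast^{\nabla^{r-1}}(q^{-1}t),\,y_\ast^{\nabla^r}(t)\bigr)=0$$ for all $t\in[q^{2r}a,b]$, where the argument in the slot $u_j$ ($0\le j\le r$) is $q^{-j(r-j)}y_\ast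^{\nabla^j}(q^{-(r-j)}t)$.
   Context: On the time scale $\mathbb{T}=\{q^k:k\in\mathbb{N}_0\}$, the forward jump operator is $\sigma(t)=qt$ and the backward jump operator is $\rho(t)=t/q$ for $t>1$ and $\rho(1)=1$; $\sigma^n,\rho^n$ denote $n$-fold composition. For a function $f$ on $[a,b]$ (or on $[q^ka,b]$), the nabla derivative at any point $t$ of the domain other than its minimum is $f^\nabla(t)=\dfrac{f(t)-f(t/q)}{t-t/q}$; higher derivatives $f^{\nabla^i}$ are obtained by iteration, each derivative removing the minimum of the domain, so $f^{\nabla^i}$ is defined on $[a,b]_{\kappa^i}=[q^ia,b]$ for $f$ on $[a,b]$; $f^{\nabla^0}=f$. The nabla integral is $\int_c^d f(t)\nabla t=\sum_{t\in\mathbb{T},\,c<t\le d}f(t)(t-t/q)$ for $c\le d$ in $\mathbb{T}$. Notation: $f^{\rho^{j}\nabla^{i}}=(f\circ\rho^j)^{\nabla^i}$ (compose first, then differentiate). $C^{2r}([a,b],\mathbb{R})$ is the set of $y:[a,b]\to\mathbb{R}$ such that $y^{\nabla^{2r}}$ is continuous on $[a,b]_{\kappa^{2r}}$. $L_{u_i}$ is the partial derivative of $L$ with respect to $u_i$, and $L_{u_i}^{\nabla^i}(t,\ldots)$ denotes the $i$-th nabla derivative of the composite function of $t$, defined on $[a,b]_{\kappa^r}=[q^ra,b]$, obtained by substituting the displayed arguments in $L_{u_i}$. $y_\ast\in C^{2r}([a,b],\mathbb{R})$ satisfying the boundary conditions is a weak local minimizer (resp. maximizer) if there is $\delta>0$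 such that $\mathcal{L}[y_\ast]\le\mathcal{L}[y]$ (resp. $\ge$) for all $y\in C^{2r}([a,b],\mathbb{R})$ satisfying the boundary conditions and $\|y-y_\ast\|_{r,\infty}<\delta$, where $\|y\|_{r,\infty}=\sum_{i=0}^r\|y^{\rho^{r-i}\nabla^i}\|_\infty$ and $\|y\|_\infty=\sup_{t\in[a,b]_{\kappa^r}}|y(t)|$. *)

theory Defs
  imports "HOL-Analysis.Analysis"
begin

definition qscale :: "real \<Rightarrow> real set" where
  "qscale q = {q ^ k | k :: nat. True}"

definition qinterval :: "real \<Rightarrow> real \<Rightarrow> real \<Rightarrow> real set" where
  "qinterval q c d = {t \<in> qscale q. c \<le> t \<and> t \<le> d}"

definition sigma :: "real \<Rightarrow> real \<Rightarrow> real" where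
  "sigma q t = q * t"

definition rho :: "real \<Rightarrow> real \<Rightarrow> real" where
  "rho q t = (if t > 1 then t / q else 1)"

(* Functions on [c,d] are represented by total functions real => real.  The value
   (nabla q ^^ i) f t is meaningful for t in [q^i c, d], and there it depends only on the
   values of f on [c,d]; every definition below evaluates it only at such points. *)
definition nabla :: "real \<Rightarrow> (real \<Rightarrow> real) \<Rightarrow> real \<Rightarrow> real" where
  "nabla q f t = (f t - f (t / q)) / (t - t / q)"

definition nabla_integral :: "real \<Rightarrow> real \<Rightarrow> real \<Rightarrow> (real \<Rightarrow> real) \<Rightarrow> real" where
  "nabla_integral q c d f = (\<Sum>t\<in>{t \<in> qscale q. c < t \<and> t \<le> d}. f t * (t - t / q))"

(* The time-scale definition of the nabla derivative, which is used only to say that such a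
   derivative exists.  Since all points of the scale are isolated, it always does, and
   it is given by nabla (see has_nabla_derivative_iff). *)
definition has_nabla_derivative ::
    "real \<Rightarrow> real set \<Rightarrow> (real \<Rightarrow> real) \<Rightarrow> real \<Rightarrow> real \<Rightarrow> bool" where
  "has_nabla_derivative q S f D t \<longleftrightarrow>
     (\<forall>\<epsilon>>0. \<exists>\<delta>>0. \<forall>s\<in>S. \<bar>s - t\<bar> < \<delta> \<longrightarrow>
        \<bar>f (rho q t) - f s - D * (rho q t - s)\<bar> \<le> \<epsilon> * \<bar>rho q t - s\<bar>)"

definition nabla_differentiable ::
    "real \<Rightarrow> nat \<Rightarrow> real \<Rightarrow> real \<Rightarrow> (real \<Rightarrow> real) \<Rightarrow> bool" where
  "nabla_differentiable q n c d f \<longleftrightarrow>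
     (\<forall>k<n. \<forall>t\<in>qinterval q (q ^ Suc k * c) d.
        \<exists>D. has_nabla_derivative q (qinterval q (q ^ k * c) d) ((nabla q ^^ k) f) D t)"

lemma qscale_isolated:
  assumes "q > 1" "s \<in> qscale q" "t \<in> qscale q" "\<bar>s - t\<bar> < t - t / q"
  shows "s = t"
proof -
  obtain k where k: "s = q ^ k" using assms(2) by (auto simp: qscale_def)
  obtain m where m: "t = q ^ m" using assms(3) by (auto simp: qscale_def)
  have pos: "q ^ n > 0" for n :: nat using assms(1) by simp
  have "k = m"
  proof (rule linorder_cases[of k m])
    assume "k < m"
    then have "q ^ Suc k \<le> q ^ m" using assms(1) by (intro power_increasing) auto
    then have "s \<le> t / q" using assms(1) k m by (simp add: field_simps)
    then show ?thesis using assms(4) by linarith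
  next
    assume "m < k"
    then have "q ^ Suc m \<le> q ^ k" using assms(1) by (intro power_increasing) auto
    then have "q * t \<le> s" using k m by simp
    moreover have "t - t / q \<le> q * t - t"
    proof -
      have "q * t - t - (t - t / q) = t * (q - 1)\<^sup>2 / q"
        using assms(1) by (simp add: field_simps power2_eq_square)
      moreover have "\<dots> \<ge> 0" using assms(1) pos m by simp
      ultimately show ?thesis by linarith
    qed
    ultimately show ?thesis using assms(4) by linarith
  qed simp
  then show ?thesis using k m by simp
qed

lemma has_nabla_derivative_iff:
  assumes "q > 1" "S \<subseteq> qscale q" "t \<in> S" "t > 1"
  shows "has_nabla_derivative q S f D t \<longleftrightarrow> D = nabla q f t"
proof -
  have h: "t - t / q > 0" using assms(1,4) by (simp add: field_simps)
  have rho: "rho q t = t / q" using assms(4) by (simp add: rho_def)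
  let ?e = "\<bar>f (t / q) - f t - D * (t / q - t)\<bar>"
  have "has_nabla_derivative q S f D t \<longleftrightarrow> (\<forall>\<epsilon>>0. ?e \<le> \<epsilon> * (t - t / q))"
  proof
    assume *: "has_nabla_derivative q S f D t"
    show "\<forall>\<epsilon>>0. ?e \<le> \<epsilon> * (t - t / q)"
    proof (intro allI impI)
      fix \<epsilon> :: real assume "\<epsilon> > 0"
      then obtain \<delta> where "\<delta> > 0" and
        d: "\<And>s. s \<in> S \<Longrightarrow> \<bar>s - t\<bar> < \<delta> \<Longrightarrow>
             \<bar>f (t / q) - f s - D * (t / q - s)\<bar> \<le> \<epsilon> * \<bar>t / q - s\<bar>"
        using * unfolding has_nabla_derivative_def rho by metis
      show "?e \<le> \<epsilon> * (t - t / q)" using d[OF assms(3)] \<open>\<delta> > 0\<close> h by simp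
    qed
  next
    assume *: "\<forall>\<epsilon>>0. ?e \<le> \<epsilon> * (t - t / q)"
    have "\<bar>f (t / q) - f s - D * (t / q - s)\<bar> \<le> \<epsilon> * \<bar>t / q - s\<bar>"
      if "\<epsilon> > 0" "s \<in> S" "\<bar>s - t\<bar> < t - t / q" for \<epsilon> s
    proof -
      have "s = t" using qscale_isolated[OF assms(1)] that assms(2,3) by blast
      then show ?thesis using * h \<open>\<epsilon> > 0\<close> by simp
    qed
    then show "has_nabla_derivative q S f D t"
      unfolding has_nabla_derivative_def rho using h by blast
  qed
  also have "\<dots> \<longleftrightarrow> ?e = 0"
  proof
    assume *: "\<forall>\<epsilon>>0. ?e \<le> \<epsilon> * (t - t / q)"
    have "?e \<le> 0 + \<epsilon>" if "\<epsilon> > 0" for \<epsilon>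
      using *[rule_format, of "\<epsilon> / (t - t / q)"] that h by simp
    then show "?e = 0" using field_le_epsilon[of ?e 0] by simp
  qed (use h in auto)
  also have "\<dots> \<longleftrightarrow> D = nabla q f t"
    using h by (auto simp: nabla_def eq_divide_eq algebra_simps)
  finally show ?thesis .
qed

(* f^(rho^j nabla^i): compose first, then differentiate *)
definition rho_nabla :: "real \<Rightarrow> nat \<Rightarrow> nat \<Rightarrow> (real \<Rightarrow> real) \<Rightarrow> real \<Rightarrow> real" where
  "rho_nabla q j i f = (nabla q ^^ i) (f \<circ> (rho q ^^ j))"

definition C_nabla :: "real \<Rightarrow> nat \<Rightarrow> real \<Rightarrow> real \<Rightarrow> (real \<Rightarrow> real) set" where
  "C_nabla q n a b = {y. continuous_on (qinterval q (q ^ n * a) b) ((nabla q ^^ n) y)}"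

(* R^(r+1), with coordinates u_0, ..., u_r.  Elements are extensional, so that the (product)
   topology on nat => real induces the Euclidean one here. *)
abbreviation coords :: "nat \<Rightarrow> (nat \<Rightarrow> real) set" where
  "coords r \<equiv> {..r} \<rightarrow>\<^sub>E UNIV"

definition partial_u ::
    "(real \<Rightarrow> (nat \<Rightarrow> real) \<Rightarrow> real) \<Rightarrow> nat \<Rightarrow> real \<Rightarrow> (nat \<Rightarrow> real) \<Rightarrow> real" where
  "partial_u L i t u = deriv (\<lambda>x. L t (u(i := x))) (u i)"

(* The Lagrangian is a function on [q^r a, b] x R^(r+1), these being the points at which the
   functional evaluates it. *)
definition admissible_lagrangian ::
    "real \<Rightarrow> nat \<Rightarrow> real \<Rightarrow> real \<Rightarrow> (real \<Rightarrow> (nat \<Rightarrow> real) \<Rightarrow> real) \<Rightarrow> bool" where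
  "admissible_lagrangian q r a b L \<longleftrightarrow>
     (\<forall>i\<le>r.
        (\<forall>t\<in>qinterval q (q ^ r * a) b. \<forall>u\<in>coords r.
           (\<lambda>x. L t (u(i := x))) differentiable at (u i)) \<and>
        continuous_on (qinterval q (q ^ r * a) b \<times> coords r) (\<lambda>(t, u). partial_u L i t u)) \<and>
     (\<forall>u\<in>coords r. nabla_differentiable q (r + 1) (q ^ r * a) b (\<lambda>t. L t u))"

definition functional ::
    "real \<Rightarrow> nat \<Rightarrow> real \<Rightarrow> real \<Rightarrow> (real \<Rightarrow> (nat \<Rightarrow> real) \<Rightarrow> real) \<Rightarrow> (real \<Rightarrow> real) \<Rightarrow> real" where
  "functional q r a b L y =
     nabla_integral q ((sigma q ^^ (r - 1)) a) b
       (\<lambda>t. L t (\<lambda>j\<in>{..r}. rho_nabla q (r - j) j y t))"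

definition feasible ::
    "real \<Rightarrow> nat \<Rightarrow> real \<Rightarrow> real \<Rightarrow> (nat \<Rightarrow> real) \<Rightarrow> (nat \<Rightarrow> real) \<Rightarrow> (real \<Rightarrow> real) set" where
  "feasible q r a b \<alpha> \<beta> =
     {y \<in> C_nabla q (2 * r) a b.
        \<forall>i<r. (nabla q ^^ i) y ((sigma q ^^ (r - 1)) a) = \<alpha> i \<and> (nabla q ^^ i) y b = \<beta> i}"

definition sup_norm :: "real \<Rightarrow> nat \<Rightarrow> real \<Rightarrow> real \<Rightarrow> (real \<Rightarrow> real) \<Rightarrow> real" where
  "sup_norm q r a b y = (SUP t\<in>qinterval q (q ^ r * a) b. \<bar>y t\<bar>)"

definition norm_r :: "real \<Rightarrow> nat \<Rightarrow> real \<Rightarrow> real \<Rightarrow> (real \<Rightarrow> real) \<Rightarrow> real" where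
  "norm_r q r a b y = (\<Sum>i\<le>r. sup_norm q r a b (rho_nabla q (r - i) i y))"

definition weak_local_minimizer ::
    "real \<Rightarrow> nat \<Rightarrow> real \<Rightarrow> real \<Rightarrow> (real \<Rightarrow> (nat \<Rightarrow> real) \<Rightarrow> real) \<Rightarrow>
     (nat \<Rightarrow> real) \<Rightarrow> (nat \<Rightarrow> real) \<Rightarrow> (real \<Rightarrow> real) \<Rightarrow> bool" where
  "weak_local_minimizer q r a b L \<alpha> \<beta> y' \<longleftrightarrow>
     y' \<in> feasible q r a b \<alpha> \<beta> \<and>
     (\<exists>\<delta>>0. \<forall>y\<in>feasible q r a b \<alpha> \<beta>. norm_r q r a b (\<lambda>t. y t - y' t) < \<delta> \<longrightarrow>
        functional q r a b L y' \<le> functional q r a b L y)"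

definition weak_local_maximizer ::
    "real \<Rightarrow> nat \<Rightarrow> real \<Rightarrow> real \<Rightarrow> (real \<Rightarrow> (nat \<Rightarrow> real) \<Rightarrow> real) \<Rightarrow>
     (nat \<Rightarrow> real) \<Rightarrow> (nat \<Rightarrow> real) \<Rightarrow> (real \<Rightarrow> real) \<Rightarrow> bool" where
  "weak_local_maximizer q r a b L \<alpha> \<beta> y' \<longleftrightarrow>
     y' \<in> feasible q r a b \<alpha> \<beta> \<and>
     (\<exists>\<delta>>0. \<forall>y\<in>feasible q r a b \<alpha> \<beta>. norm_r q r a b (\<lambda>t. y t - y' t) < \<delta> \<longrightarrow>
        functional q r a b L y' \<ge> functional q r a b L y)"

end

theory Submission
  imports Defs
begin

text \<open>All points of the scale are isolated, so \<open>y\<close> may be perturbed at a single point \<open>s\<close>.  For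
  \<open>t \<in> [q\<^sup>2\<^sup>r a, b]\<close> the perturbation at \<open>s = q\<^sup>-\<^sup>r t\<close> respects all boundary conditions, so the
  derivative of the functional along it vanishes.  Summation by parts then collapses this
  derivative to the Euler expression at \<open>t\<close>, times the positive factor \<open>q\<^sup>r (s - s / q)\<close>; the weights
  \<open>q\<^bsup>i(i-1)/2\<^esup>\<close> are what remains after commuting the nabla derivative with dilations by powers
  of \<open>q\<close>.\<close>

section \<open>Iterated nabla derivatives: linearity, dilations, locality\<close>

lemma nabla_scale: "c \<noteq> 0 \<Longrightarrow> nabla q (\<lambda>s. f (c * s)) t = c * nabla q f (c * t)"
proof -
  assume c: "c \<noteq> 0"
  have "nabla q f (c * t) = (f (c * t) - f (c * (t / q))) / (c * (t - t / q))"
    unfolding nabla_def by (simp add: right_diff_distrib)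
  then show ?thesis unfolding nabla_def[of q "\<lambda>s. f (c * s)"] using c by simp
qed

lemma nabla_pow_Suc:
  "(nabla q ^^ Suc i) f t = ((nabla q ^^ i) f t - (nabla q ^^ i) f (t / q)) / (t - t / q)"
  by (simp add: nabla_def[of q "(nabla q ^^ i) f"])

lemma nabla_affine:
  "nabla q (\<lambda>t. f t + c * g t) = (\<lambda>t. nabla q f t + c * nabla q g t)"
  by (rule ext) (simp add: nabla_def add_divide_distrib diff_divide_distrib algebra_simps)

lemma nabla_mult: "nabla q (\<lambda>t. c * g t) = (\<lambda>t. c * nabla q g t)"
  by (rule ext) (simp add: nabla_def right_diff_distrib)

lemma nabla_pow_affine:
  "(nabla q ^^ i) (\<lambda>t. f t + c * g t) = (\<lambda>t. (nabla q ^^ i) f t + c * (nabla q ^^ i) g t)"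
  by (induction i) (simp_all add: nabla_affine)

lemma nabla_pow_mult: "(nabla q ^^ i) (\<lambda>t. c * g t) = (\<lambda>t. c * (nabla q ^^ i) g t)"
  by (induction i) (simp_all add: nabla_mult)

text \<open>Each differentiation of a dilated function contributes one factor \<open>c\<close>. This
  is the source of the factors \<open>q powi (- int (j * (r - j)))\<close> in the slots of the Euler
  expression.\<close>

lemma nabla_pow_scale:
  assumes "c \<noteq> 0"
  shows "(nabla q ^^ i) (\<lambda>s. f (c * s)) t = c ^ i * (nabla q ^^ i) f (c * t)"
proof (induction i arbitrary: t)
  case (Suc i)
  have "(nabla q ^^ i) (\<lambda>s. f (c * s)) = (\<lambda>t. c ^ i * (nabla q ^^ i) f (c * t))"
    using Suc by blast
  then show ?case by (simp add: nabla_mult nabla_scale[OF assms])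
qed simp

text \<open>Each differentiation reaches one scale point further to the left. This locality allows
  \<open>rho\<close> to be replaced by division by \<open>q\<close>, with which it agrees only above
  1.\<close>

lemma nabla_pow_cong:
  assumes "\<And>l. l \<le> i \<Longrightarrow> f (t / q ^ l) = g (t / q ^ l)"
  shows "(nabla q ^^ i) f t = (nabla q ^^ i) g t"
  using assms
proof (induction i arbitrary: t)
  case (Suc i)
  have "(nabla q ^^ i) f t = (nabla q ^^ i) g t"
    using Suc.prems by (intro Suc.IH) simp
  moreover have "(nabla q ^^ i) f (t / q) = (nabla q ^^ i) g (t / q)"
    using Suc.prems[of "Suc _"] by (intro Suc.IH) (simp add: field_simps)
  ultimately show ?case unfolding nabla_pow_Suc by simp
qed (use assms[of 0] in simp)

section \<open>Point perturbations and summation by parts\<close>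

text \<open>The difference quotient at \<open>t\<close> sees only \<open>t\<close> and
  \<open>t / q\<close>, so each differentiation extends the support by one step to the
  right.\<close>

lemma nabla_pow_support:
  assumes "q \<noteq> 0" "(nabla q ^^ i) (indicator {s}) t \<noteq> 0"
  shows "\<exists>k\<le>i. t = q ^ k * s"
  using assms(2)
proof (induction i arbitrary: t)
  case 0
  then show ?case by (simp add: indicator_def split: if_splits)
next
  case (Suc i)
  then have "(nabla q ^^ i) (indicator {s}) t \<noteq> 0 \<or> (nabla q ^^ i) (indicator {s}) (t / q) \<noteq> 0"
    unfolding nabla_pow_Suc by force
  then show ?case
  proof
    assume "(nabla q ^^ i) (indicator {s}) t \<noteq> 0"
    then show ?thesis using Suc.IH by (meson le_SucI)
  next
    assume "(nabla q ^^ i) (indicator {s}) (t / q) \<noteq> 0"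
    then obtain k where "k \<le> i" "t / q = q ^ k * s" using Suc.IH by blast
    then have "Suc k \<le> Suc i" "t = q ^ Suc k * s" using assms(1) by (simp_all add: field_simps)
    then show ?thesis by blast
  qed
qed

text \<open>One summation by parts removes a derivative from the indicator and replaces
  \<open>F\<close> by \<open>x\<close> \<mapsto> \<open>- q * nabla q F (q * x)\<close>; hence the
  induction generalizes over \<open>F\<close>. The exponent is the triangular number 1 + ... + i:
  the remaining \<open>i\<close> derivatives of the dilated function give \<open>q ^ i\<close>, and
  the prefactor gives one more \<open>q\<close>.\<close>

lemma summation_by_parts:
  assumes "q > 1" "s > 0"
  shows "(\<Sum>k\<le>i. F (q ^ k * s) * (nabla q ^^ i) (indicator {s}) (q ^ k * s)
            * (q ^ k * s - q ^ k * s / q))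
       = (- 1) ^ i * q ^ (i + i * (i - 1) div 2) * (nabla q ^^ i) F (q ^ i * s) * (s - s / q)"
proof (induction i arbitrary: F)
  case (Suc i)
  let ?g = "(nabla q ^^ i) (indicator {s})"
  let ?F = "\<lambda>x. (- q) * nabla q F (q * x)"
  \<comment> \<open>The support of \<open>?g\<close> lies in \<open>s\<close>, ...,
    \<open>q ^ i * s\<close>, so both boundary terms of the summation by parts vanish.\<close>
  have top: "?g (q ^ Suc i * s) = 0"
  proof (rule ccontr)
    assume "?g (q ^ Suc i * s) \<noteq> 0"
    then obtain k where "k \<le> i" "q ^ Suc i * s = q ^ k * s"
      using nabla_pow_support[of q i s "q ^ Suc i * s"] assms(1) by force
    then have "q ^ Suc i = q ^ k" using assms(2) by (metis less_irrefl mult_right_cancel)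
    then have "Suc i = k" using assms(1) power_inject_exp by blast
    then show False using \<open>k \<le> i\<close> by simp
  qed
  have bot: "?g (s / q) = 0"
  proof (rule ccontr)
    assume "?g (s / q) \<noteq> 0"
    then obtain k where "s / q = q ^ k * s" using nabla_pow_support[of q i s] assms by auto
    then have "q ^ Suc k = 1" using assms by (simp add: field_simps)
    then show False using assms(1) one_less_power[of q "Suc k"] by simp
  qed
  have pos: "q ^ k * s - q ^ k * s / q > 0" for k
    using assms by (simp add: field_simps)
  \<comment> \<open>The integration weight is exactly the denominator of the outermost nabla
    derivative.\<close>
  have "(\<Sum>k\<le>Suc i. F (q ^ k * s) * (nabla q ^^ Suc i) (indicator {s}) (q ^ k * s)
            * (q ^ k * s - q ^ k * s / q))
      = (\<Sum>k\<le>Suc i. F (q ^ k * s) * (?g (q ^ k * s) - ?g (q ^ k * s / q)))"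
    using pos by (intro sum.cong) (simp_all add: nabla_pow_Suc less_imp_neq[THEN not_sym]
        del: funpow.simps)
  also have "\<dots> = (\<Sum>k\<le>Suc i. F (q ^ k * s) * ?g (q ^ k * s))
      - (\<Sum>k\<le>Suc i. F (q ^ k * s) * ?g (q ^ k * s / q))"
    by (simp add: right_diff_distrib sum_subtractf)
  also have "(\<Sum>k\<le>Suc i. F (q ^ k * s) * ?g (q ^ k * s)) = (\<Sum>k\<le>i. F (q ^ k * s) * ?g (q ^ k * s))"
    using top by simp
  also have "(\<Sum>k\<le>Suc i. F (q ^ k * s) * ?g (q ^ k * s / q))
      = (\<Sum>k\<le>i. F (q * (q ^ k * s)) * ?g (q ^ k * s))"
    using bot assms by (subst sum.atMost_Suc_shift) (simp add: mult.assoc)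
  also have "(\<Sum>k\<le>i. F (q ^ k * s) * ?g (q ^ k * s)) - \<dots>
      = (\<Sum>k\<le>i. ?F (q ^ k * s) * ?g (q ^ k * s) * (q ^ k * s - q ^ k * s / q))"
  proof -
    \<comment> \<open>The step ending at \<open>q * x\<close> is \<open>q\<close> times the step
      ending at \<open>x\<close>, whence the factor \<open>q\<close> in \<open>?F\<close>.\<close>
    have diff_eq: "F x - F (q * x) = ?F x * (x - x / q)" if "x > 0" for x
    proof -
      have "q * x - x \<noteq> 0" using that assms by simp
      moreover have "?F x * (x - x / q) = - (nabla q F (q * x) * (q * x - x))"
        using assms by (simp add: field_simps)
      ultimately show ?thesis using assms by (simp add: nabla_def)
    qed
    have "?F (q ^ k * s) * ?g (q ^ k * s) * (q ^ k * s - q ^ k * s / q)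
        = F (q ^ k * s) * ?g (q ^ k * s) - F (q * (q ^ k * s)) * ?g (q ^ k * s)" for k
    proof -
      have "F (q ^ k * s) - F (q * (q ^ k * s)) = ?F (q ^ k * s) * (q ^ k * s - q ^ k * s / q)"
        using assms by (intro diff_eq) simp
      then show ?thesis
        by (simp only: left_diff_distrib[symmetric] mult.assoc mult.commute[of "?g _"])
    qed
    then show ?thesis by (simp only: sum_subtractf)
  qed
  also have "\<dots> = (- 1) ^ i * q ^ (i + i * (i - 1) div 2) * (nabla q ^^ i) ?F (q ^ i * s) * (s - s / q)"
    by (rule Suc.IH)
  also have "(nabla q ^^ i) ?F (q ^ i * s) = - q * (q ^ i * (nabla q ^^ Suc i) F (q ^ Suc i * s))"
  proof -
    have "(nabla q ^^ i) ?F (q ^ i * s) = - q * (nabla q ^^ i) (\<lambda>x. nabla q F (q * x)) (q ^ i * s)"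
      by (subst nabla_pow_mult) simp
    also have "(nabla q ^^ i) (\<lambda>x. nabla q F (q * x)) (q ^ i * s)
        = q ^ i * (nabla q ^^ i) (nabla q F) (q * (q ^ i * s))"
      using assms by (intro nabla_pow_scale) simp
    finally show ?thesis by (simp add: funpow_swap1 mult.assoc)
  qed
  also have "(- 1) ^ i * q ^ (i + i * (i - 1) div 2)
        * (- q * (q ^ i * (nabla q ^^ Suc i) F (q ^ Suc i * s))) * (s - s / q)
      = (- 1) ^ Suc i * q ^ (Suc i + (i + i * (i - 1) div 2)) * (nabla q ^^ Suc i) F (q ^ Suc i * s)
        * (s - s / q)"
    by (simp add: power_add)
  also have "i + i * (i - 1) div 2 = Suc i * (Suc i - 1) div 2"
    by (cases i) (simp_all add: algebra_simps)
  finally show ?case .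
qed simp

section \<open>Backward jumps as dilations\<close>

text \<open>The bound \<open>n \<le> k\<close> ensures that \<open>rho\<close> is only ever applied
  at points above 1, where it divides by \<open>q\<close>.\<close>

lemma rho_funpow:
  assumes "q > 1" "n \<le> k"
  shows "(rho q ^^ n) (q ^ k) = q ^ (k - n)"
  using assms(2)
proof (induction n)
  case (Suc n)
  then obtain d where d: "k - n = Suc d" "k - Suc n = d" by (metis Suc_diff_Suc Suc_le_lessD)
  have "q ^ Suc d > 1" using assms(1) by (rule one_less_power) simp
  then show ?case using Suc d assms(1) by (simp add: rho_def)
qed simp

text \<open>The derivative of order \<open>j\<close> at \<open>q ^ k\<close> uses only the points
  down to \<open>q ^ (k - j)\<close>. From there \<open>r - j\<close> backward jumps stay within the
  scale because \<open>r \<le> k\<close>, so composing with \<open>rho\<close> acts as a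
  dilation.\<close>

lemma rho_nabla_eq:
  assumes "q > 1" "j \<le> r" "r \<le> k"
  shows "rho_nabla q (r - j) j f (q ^ k)
       = q powi (- int (j * (r - j))) * (nabla q ^^ j) f (q powi (- int (r - j)) * q ^ k)"
proof -
  let ?c = "q powi (- int (r - j))"
  have "rho_nabla q (r - j) j f (q ^ k) = (nabla q ^^ j) (\<lambda>s. f (?c * s)) (q ^ k)"
    unfolding rho_nabla_def
  proof (rule nabla_pow_cong)
    fix l assume "l \<le> j"
    then have "q ^ k / q ^ l = q ^ (k - l)" "r - j \<le> k - l"
      using assms by (simp_all add: power_diff)
    moreover have "?c * q ^ (k - l) = q ^ (k - l - (r - j))"
      unfolding power_int_minus power_int_of_nat
      using calculation(2) assms(1) by (subst power_diff) (auto simp: field_simps)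
    ultimately show "(f \<circ> rho q ^^ (r - j)) (q ^ k / q ^ l) = f (?c * (q ^ k / q ^ l))"
      using assms(1) by (simp only: comp_apply rho_funpow)
  qed
  also have "\<dots> = ?c ^ j * (nabla q ^^ j) f (?c * q ^ k)"
    using assms by (intro nabla_pow_scale) simp
  also have "?c ^ j = q powi (- int (j * (r - j)))"
    by (simp add: power_int_minus power_mult[symmetric] power_inverse mult.commute
        flip: of_nat_mult)
  finally show ?thesis .
qed

lemma rho_nabla_affine:
  "rho_nabla q k i (\<lambda>t. f t + c * g t) t = rho_nabla q k i f t + c * rho_nabla q k i g t"
  unfolding rho_nabla_def comp_def by (simp add: nabla_pow_affine)

lemma rho_nabla_mult: "rho_nabla q k i (\<lambda>t. c * g t) t = c * rho_nabla q k i g t"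
  unfolding rho_nabla_def comp_def by (simp add: nabla_pow_mult)

section \<open>Finite intervals and the norm\<close>

lemma qinterval_image:
  assumes "q > 1"
  shows "qinterval q (q ^ m) (q ^ n) = (\<lambda>k. q ^ k) ` {m..n}"
  using assms by (auto simp: qinterval_def qscale_def)

lemma finite_qinterval:
  assumes "q > 1" "b \<in> qscale q"
  shows "finite (qinterval q c b)"
proof -
  obtain n where "b = q ^ n" using assms(2) by (auto simp: qscale_def)
  then have "qinterval q c b \<subseteq> (\<lambda>k. q ^ k) ` {..n}"
    using assms(1) by (auto simp: qinterval_def qscale_def)
  then show ?thesis using finite_surj by blast
qed

text \<open>The interval is finite, so the supremum bounds every value. Through
  \<open>norm_r_mult_le\<close> this makes small multiples of a variation small in the norm.\<close>

lemma sup_norm_mult_le: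
  assumes "q > 1" "b \<in> qscale q" "qinterval q (q ^ r * a) b \<noteq> {}"
  shows "sup_norm q r a b (\<lambda>t. c * f t) \<le> \<bar>c\<bar> * sup_norm q r a b f"
  unfolding sup_norm_def
proof (rule cSUP_least[OF assms(3)])
  fix t assume "t \<in> qinterval q (q ^ r * a) b"
  then have "\<bar>f t\<bar> \<le> (SUP t\<in>qinterval q (q ^ r * a) b. \<bar>f t\<bar>)"
    using finite_qinterval[OF assms(1,2)] by (intro cSUP_upper) auto
  then show "\<bar>c * f t\<bar> \<le> \<bar>c\<bar> * (SUP t\<in>qinterval q (q ^ r * a) b. \<bar>f t\<bar>)"
    by (simp add: abs_mult mult_left_mono)
qed

lemma norm_r_mult_le:
  assumes "q > 1" "b \<in> qscale q" "qinterval q (q ^ r * a) b \<noteq> {}"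
  shows "norm_r q r a b (\<lambda>t. c * f t) \<le> \<bar>c\<bar> * norm_r q r a b f"
  unfolding norm_r_def sum_distrib_left rho_nabla_mult
  by (intro sum_mono sup_norm_mult_le assms)

section \<open>Differentiating the Lagrangian along a line\<close>

text \<open>The coordinates are switched on one at a time, by the mean value theorem.\<close>

lemma has_derivative_along_line:
  fixes f :: "(nat \<Rightarrow> real) \<Rightarrow> real" and U V :: "nat \<Rightarrow> real"
  assumes diff: "\<And>i u. i \<le> r \<Longrightarrow> u \<in> coords r \<Longrightarrow> (\<lambda>x. f (u(i := x))) differentiable at (u i)"
    and cont: "\<And>i. i \<le> r \<Longrightarrow> continuous_on (coords r) (\<lambda>u. deriv (\<lambda>x. f (u(i := x))) (u i))"
  shows "((\<lambda>\<epsilon>. f (\<lambda>j\<in>{..r}. U j + \<epsilon> * V j)) has_real_derivative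
           (\<Sum>i\<le>r. V i * deriv (\<lambda>x. f ((restrict U {..r})(i := x))) (U i))) (at 0)"
proof -
  define D where "D i u = deriv (\<lambda>x. f (u(i := x))) (u i)" for i and u :: "nat \<Rightarrow> real"
  \<comment> \<open>Coordinates below \<open>n\<close> are already moved by
    \<open>\<epsilon>\<close>, coordinate \<open>n\<close> is moved by \<open>s\<close>, and the
    later ones are still at \<open>U\<close>. By \<open>P_Suc\<close>, the end of one stage is the
    start of the next.\<close>
  define P where "P n \<epsilon> s = (\<lambda>j\<in>{..r}. if j < n then U j + \<epsilon> * V j
      else if j = n then U j + s * V j else U j)" for n \<epsilon> s
  have P_in: "P n \<epsilon> s \<in> coords r" for n \<epsilon> s by (simp add: P_def)
  have P0: "P n 0 0 = restrict U {..r}" for n by (auto simp: P_def)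
  have P_Suc: "P (Suc n) \<epsilon> 0 = P n \<epsilon> \<epsilon>" for n \<epsilon> by (auto simp: P_def)
  have der: "((\<lambda>s. f (P n \<epsilon> s)) has_real_derivative V n * D n (P n \<epsilon> s)) (at s)" if "n \<le> r" for n \<epsilon> s
  proof -
    have "((\<lambda>x. f ((P n \<epsilon> s)(n := x))) has_real_derivative D n (P n \<epsilon> s)) (at (U n + s * V n))"
      using diff[OF that P_in, of n \<epsilon> s] that
      by (simp add: D_def P_def DERIV_deriv_iff_real_differentiable)
    moreover have "((\<lambda>x. U n + x * V n) has_real_derivative V n) (at s)"
      by (auto intro!: derivative_eq_intros)
    ultimately have "((\<lambda>x. f ((P n \<epsilon> s)(n := U n + x * V n))) has_real_derivative
        D n (P n \<epsilon> s) * V n) (at s)"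
      by (rule DERIV_chain2)
    moreover have "(P n \<epsilon> s)(n := U n + x * V n) = P n \<epsilon> x" for x
      using that by (auto simp: P_def)
    ultimately show ?thesis by (simp add: mult.commute)
  qed
  have step: "((\<lambda>\<epsilon>. f (P n \<epsilon> \<epsilon>) - f (P n \<epsilon> 0)) has_real_derivative V n * D n (restrict U {..r})) (at 0)"
    if n: "n \<le> r" for n
  proof -
    \<comment> \<open>The mean value theorem is applied on [0, 1] to the rescaled path, which covers
      both signs of \<open>\<epsilon>\<close> at once.\<close>
    have "\<exists>z. 0 < z \<and> z < 1 \<and> f (P n \<epsilon> \<epsilon>) - f (P n \<epsilon> 0) = \<epsilon> * (V n * D n (P n \<epsilon> (z * \<epsilon>)))" for \<epsilon>
    proof -
      have "((\<lambda>z. f (P n \<epsilon> (z * \<epsilon>))) has_real_derivative V n * D n (P n \<epsilon> (z * \<epsilon>)) * \<epsilon>) (at z)" for z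
        by (rule DERIV_chain2[OF der[OF n]]) (auto intro!: derivative_eq_intros)
      from MVT2[OF zero_less_one this] show ?thesis by (auto simp: mult_ac)
    qed
    then obtain z where z: "\<And>\<epsilon>. 0 < z \<epsilon> \<and> z \<epsilon> < 1"
      "\<And>\<epsilon>. f (P n \<epsilon> \<epsilon>) - f (P n \<epsilon> 0) = \<epsilon> * (V n * D n (P n \<epsilon> (z \<epsilon> * \<epsilon>)))" by metis
    have "continuous_on UNIV (\<lambda>p. P n (fst p) (snd p))"
    proof (rule continuous_on_coordinatewise_then_product)
      fix j show "continuous_on UNIV (\<lambda>p. P n (fst p) (snd p) j)"
        by (cases "j < n"; cases "j = n"; cases "j \<le> r")
          (simp_all add: P_def continuous_intros)
    qed
    then have "continuous_on UNIV (\<lambda>p. D n (P n (fst p) (snd p)))"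
      by (rule continuous_on_compose2[OF cont[OF n, folded D_def]]) (use P_in in auto)
    \<comment> \<open>The choice \<open>z\<close> need not be continuous; its values lie between 0
      and 1, so squeezing suffices.\<close>
    moreover have "((\<lambda>\<epsilon>. z \<epsilon> * \<epsilon>) \<longlongrightarrow> 0) (at 0)"
    proof (rule tendsto_rabs_zero_cancel, rule tendsto_sandwich)
      show "\<forall>\<^sub>F \<epsilon> in at 0. 0 \<le> \<bar>z \<epsilon> * \<epsilon>\<bar>" by simp
      have "\<bar>z \<epsilon> * \<epsilon>\<bar> \<le> \<bar>\<epsilon>\<bar>" for \<epsilon>
        using z(1)[of \<epsilon>] mult_right_mono[of "z \<epsilon>" 1 "\<bar>\<epsilon>\<bar>"] by (simp add: abs_mult)
      then show "\<forall>\<^sub>F \<epsilon> in at 0. \<bar>z \<epsilon> * \<epsilon>\<bar> \<le> \<bar>\<epsilon>\<bar>" by simp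
      show "((\<lambda>\<epsilon>::real. \<bar>\<epsilon>\<bar>) \<longlongrightarrow> 0) (at 0)" by (rule tendsto_rabs_zero) (rule tendsto_ident_at)
    qed simp
    then have "((\<lambda>\<epsilon>. (\<epsilon>, z \<epsilon> * \<epsilon>)) \<longlongrightarrow> (0, 0)) (at 0)"
      by (intro tendsto_Pair tendsto_ident_at)
    ultimately have "((\<lambda>\<epsilon>. D n (P n \<epsilon> (z \<epsilon> * \<epsilon>))) \<longlongrightarrow> D n (P n 0 0)) (at 0)"
      using continuous_on_tendsto_compose[of UNIV "\<lambda>p. D n (P n (fst p) (snd p))"
          "\<lambda>\<epsilon>. (\<epsilon>, z \<epsilon> * \<epsilon>)" "(0, 0)" "at 0"] by simp
    then have "((\<lambda>\<epsilon>. V n * D n (P n \<epsilon> (z \<epsilon> * \<epsilon>))) \<longlongrightarrow> V n * D n (restrict U {..r})) (at 0)"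
      unfolding P0 by (rule tendsto_mult_left)
    then have "((\<lambda>\<epsilon>. (f (P n \<epsilon> \<epsilon>) - f (P n \<epsilon> 0)) / \<epsilon>) \<longlongrightarrow> V n * D n (restrict U {..r})) (at 0)"
      by (rule Lim_transform_eventually) (auto simp: z(2) eventually_at_filter)
    then show ?thesis unfolding DERIV_def by simp
  qed
  \<comment> \<open>The increments of the stages telescope, each adding its own term to the
    derivative.\<close>
  have "((\<lambda>\<epsilon>. f (P n \<epsilon> 0)) has_real_derivative (\<Sum>i<n. V i * D i (restrict U {..r}))) (at 0)"
    if "n \<le> Suc r" for n
    using that
  proof (induction n)
    case 0
    then show ?case by (simp add: P_def)
  next
    case (Suc n)
    have "((\<lambda>\<epsilon>. f (P n \<epsilon> 0) + (f (P n \<epsilon> \<epsilon>) - f (P n \<epsilon> 0))) has_real_derivative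
        (\<Sum>i<n. V i * D i (restrict U {..r})) + V n * D n (restrict U {..r})) (at 0)"
      using Suc.prems by (intro DERIV_add step Suc.IH) simp_all
    then show ?case by (simp add: P_Suc del: restrict_apply)
  qed
  from this[of "Suc r"] have "((\<lambda>\<epsilon>. f (P (Suc r) \<epsilon> 0)) has_real_derivative
      (\<Sum>i\<le>r. V i * D i (restrict U {..r}))) (at 0)"
    by (simp only: lessThan_Suc_atMost)
  moreover have "P (Suc r) \<epsilon> 0 = (\<lambda>j\<in>{..r}. U j + \<epsilon> * V j)" for \<epsilon> by (auto simp: P_def)
  moreover have "(\<Sum>i\<le>r. V i * D i (restrict U {..r}))
      = (\<Sum>i\<le>r. V i * deriv (\<lambda>x. f ((restrict U {..r})(i := x))) (U i))"
    by (rule sum.cong) (simp_all add: D_def)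
  ultimately show ?thesis by simp
qed

section \<open>The functional as a finite sum, and its first variation\<close>

text \<open>The nabla integral omits its lower limit \<open>q ^ (r - 1) * a\<close>, so summation
  starts one point later, at \<open>q ^ r * a\<close>.\<close>

lemma functional_qinterval:
  assumes "q > 1" "r \<ge> 1" "a \<in> qscale q"
  shows "functional q r a b L y = (\<Sum>t\<in>qinterval q (q ^ r * a) b.
           L t (\<lambda>j\<in>{..r}. rho_nabla q (r - j) j y t) * (t - t / q))"
proof -
  obtain m where m: "a = q ^ m" using assms(3) by (auto simp: qscale_def)
  have sig: "(sigma q ^^ n) a = q ^ (n + m)" for n
    by (induction n) (simp_all add: m sigma_def)
  have "q ^ (r - 1 + m) < q ^ k \<longleftrightarrow> q ^ (r + m) \<le> q ^ k" for k
    using assms by auto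
  then have "{t \<in> qscale q. (sigma q ^^ (r - 1)) a < t \<and> t \<le> b} = qinterval q (q ^ r * a) b"
    unfolding sig by (auto simp: qinterval_def qscale_def m power_add)
  then show ?thesis by (simp add: functional_def nabla_integral_def)
qed

text \<open>The conditions on \<open>\<eta>\<close> keep every \<open>y + \<epsilon> \<eta>\<close>
  feasible, and for small \<open>\<epsilon>\<close> it is close to \<open>y\<close> in the norm. The
  functional along this line thus has a local extremum at 0, and its derivative there, the stated
  sum, is zero.\<close>

lemma first_variation:
  assumes q: "q > 1" and r: "r \<ge> 1" and a: "a \<in> qscale q" and b: "b \<in> qscale q"
    and ne: "qinterval q (q ^ r * a) b \<noteq> {}"
    and L: "admissible_lagrangian q r a b L"
    and y: "weak_local_minimizer q r a b L \<alpha> \<beta> y \<or> weak_local_maximizer q r a b L \<alpha> \<beta> y"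
    and left: "\<And>i. i < r \<Longrightarrow> (nabla q ^^ i) \<eta> ((sigma q ^^ (r - 1)) a) = 0"
    and right: "\<And>i. i < r \<Longrightarrow> (nabla q ^^ i) \<eta> b = 0"
  shows "(\<Sum>t\<in>qinterval q (q ^ r * a) b. (\<Sum>i\<le>r. rho_nabla q (r - i) i \<eta> t *
            partial_u L i t (\<lambda>j\<in>{..r}. rho_nabla q (r - j) j y t)) * (t - t / q)) = 0"
    (is "?S = 0")
proof -
  let ?\<Phi> = "\<lambda>\<epsilon>. functional q r a b L (\<lambda>t. y t + \<epsilon> * \<eta> t)"
  have "((\<lambda>\<epsilon>. L t (\<lambda>j\<in>{..r}. rho_nabla q (r - j) j y t + \<epsilon> * rho_nabla q (r - j) j \<eta> t))
      has_real_derivative (\<Sum>i\<le>r. rho_nabla q (r - i) i \<eta> t *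
        partial_u L i t (\<lambda>j\<in>{..r}. rho_nabla q (r - j) j y t))) (at 0)"
    if t: "t \<in> qinterval q (q ^ r * a) b" for t
  proof -
    have "continuous_on (coords r) (\<lambda>u. partial_u L i t u)" if "i \<le> r" for i
    proof -
      have "continuous_on (qinterval q (q ^ r * a) b \<times> coords r) (\<lambda>(t, u). partial_u L i t u)"
        using L that by (simp add: admissible_lagrangian_def)
      moreover have "continuous_on (coords r) (\<lambda>u. (t, u))" by (intro continuous_intros)
      ultimately have "continuous_on (coords r) (\<lambda>u. (\<lambda>(t, u). partial_u L i t u) (t, u))"
        by (rule continuous_on_compose2) (use t in auto)
      then show ?thesis by simp
    qed
    then have "((\<lambda>\<epsilon>. L t (\<lambda>j\<in>{..r}. rho_nabla q (r - j) j y t + \<epsilon> * rho_nabla q (r - j) j \<eta> t))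
        has_real_derivative (\<Sum>i\<le>r. rho_nabla q (r - i) i \<eta> t *
          deriv (\<lambda>x. L t ((\<lambda>j\<in>{..r}. rho_nabla q (r - j) j y t)(i := x)))
            (rho_nabla q (r - i) i y t))) (at 0)"
      using L t unfolding partial_u_def
      by (intro has_derivative_along_line) (simp_all add: admissible_lagrangian_def del: fun_upd_apply)
    moreover have "(\<Sum>i\<le>r. rho_nabla q (r - i) i \<eta> t *
          deriv (\<lambda>x. L t ((\<lambda>j\<in>{..r}. rho_nabla q (r - j) j y t)(i := x)))
            (rho_nabla q (r - i) i y t))
        = (\<Sum>i\<le>r. rho_nabla q (r - i) i \<eta> t *
            partial_u L i t (\<lambda>j\<in>{..r}. rho_nabla q (r - j) j y t))"
      by (rule sum.cong) (simp_all add: partial_u_def)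
    ultimately show ?thesis by simp
  qed
  then have der: "(?\<Phi> has_real_derivative ?S) (at 0)"
    unfolding functional_qinterval[OF q r a] rho_nabla_affine
    by (intro DERIV_sum DERIV_cmult_right) simp
  \<comment> \<open>The required continuity is automatic on a finite set.\<close>
  have feas: "(\<lambda>t. y t + \<epsilon> * \<eta> t) \<in> feasible q r a b \<alpha> \<beta>" for \<epsilon>
  proof -
    have "y \<in> feasible q r a b \<alpha> \<beta>"
      using y by (auto simp: weak_local_minimizer_def weak_local_maximizer_def)
    then show ?thesis
      using left right by (simp add: feasible_def C_nabla_def nabla_pow_affine
          continuous_on_finite finite_qinterval[OF q b])
  qed
  have small: "\<exists>d>0. \<forall>\<epsilon>. \<bar>0 - \<epsilon>\<bar> < d \<longrightarrow> norm_r q r a b (\<lambda>t. (y t + \<epsilon> * \<eta> t) - y t) < \<delta>"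
    if \<delta>: "\<delta> > 0" for \<delta>
  proof (intro exI conjI allI impI)
    \<comment> \<open>The added 1 makes the divisor positive even if the norm of
      \<open>\<eta>\<close> is zero.\<close>
    let ?K = "\<bar>norm_r q r a b \<eta>\<bar> + 1"
    show "\<delta> / ?K > 0" using \<delta> by (simp add: divide_pos_pos)
    fix \<epsilon> assume "\<bar>0 - \<epsilon>\<bar> < \<delta> / ?K"
    then have e: "\<bar>\<epsilon>\<bar> * ?K < \<delta>" by (simp add: pos_less_divide_eq)
    have "norm_r q r a b (\<lambda>t. \<epsilon> * \<eta> t) \<le> \<bar>\<epsilon>\<bar> * norm_r q r a b \<eta>"
      by (rule norm_r_mult_le[OF q b ne])
    also have "\<dots> \<le> \<bar>\<epsilon>\<bar> * ?K" by (intro mult_left_mono) auto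
    finally show "norm_r q r a b (\<lambda>t. (y t + \<epsilon> * \<eta> t) - y t) < \<delta>" using e by simp
  qed
  from y show ?thesis
  proof
    assume "weak_local_minimizer q r a b L \<alpha> \<beta> y"
    then obtain \<delta> where \<delta>: "\<delta> > 0" "\<And>z. z \<in> feasible q r a b \<alpha> \<beta> \<Longrightarrow>
        norm_r q r a b (\<lambda>t. z t - y t) < \<delta> \<Longrightarrow> functional q r a b L y \<le> functional q r a b L z"
      by (auto simp: weak_local_minimizer_def)
    obtain d where "d > 0" "\<And>\<epsilon>. \<bar>0 - \<epsilon>\<bar> < d \<Longrightarrow> ?\<Phi> 0 \<le> ?\<Phi> \<epsilon>"
      using small[OF \<delta>(1)] \<delta>(2)[OF feas] by auto
    then show ?thesis using DERIV_local_min[OF der] by blast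
  next
    assume "weak_local_maximizer q r a b L \<alpha> \<beta> y"
    then obtain \<delta> where \<delta>: "\<delta> > 0" "\<And>z. z \<in> feasible q r a b \<alpha> \<beta> \<Longrightarrow>
        norm_r q r a b (\<lambda>t. z t - y t) < \<delta> \<Longrightarrow> functional q r a b L y \<ge> functional q r a b L z"
      by (auto simp: weak_local_maximizer_def)
    obtain d where "d > 0" "\<And>\<epsilon>. \<bar>0 - \<epsilon>\<bar> < d \<Longrightarrow> ?\<Phi> \<epsilon> \<le> ?\<Phi> 0"
      using small[OF \<delta>(1)] \<delta>(2)[OF feas] by auto
    then show ?thesis using DERIV_local_max[OF der] by blast
  qed
qed

section \<open>Testing with a point perturbation, and the Euler equation\<close>

text \<open>Undoing the dilation by \<open>q ^ (r - i)\<close> reduces the sum to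
  \<open>summation_by_parts\<close>. The prefactor \<open>q ^ r * (q ^ p - q ^ p / q)\<close> does
  not depend on \<open>i\<close>, so it can later be taken out of the sum over the slots.\<close>

lemma sum_against_indicator:
  assumes q: "q > 1" and "i \<le> r" "m + r \<le> p" "p + r \<le> n"
  shows "(\<Sum>t\<in>qinterval q (q ^ r * q ^ m) (q ^ n).
            rho_nabla q (r - i) i (indicator {q ^ p}) t * F t * (t - t / q))
       = q ^ r * (q ^ p - q ^ p / q) *
           ((- 1) ^ i * q ^ (i * (i - 1) div 2) * (nabla q ^^ i) F (q ^ (r + p)))"
proof -
  let ?g = "(nabla q ^^ i) (indicator {q ^ p})"
  let ?e = "q ^ (i * (r - i))"
  have set: "qinterval q (q ^ r * q ^ m) (q ^ n) = (\<lambda>k. q ^ k) ` {r + m..n}"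
    using qinterval_image[OF q, of "r + m" n] by (simp add: power_add)
  have inj: "inj_on (\<lambda>k. q ^ k) A" for A :: "nat set"
    using q by (auto intro!: inj_onI)
  let ?h = "\<lambda>k. inverse ?e * ?g (q powi (- int (r - i)) * q ^ k) * F (q ^ k) * (q ^ k - q ^ k / q)"
  have "(\<Sum>t\<in>qinterval q (q ^ r * q ^ m) (q ^ n).
            rho_nabla q (r - i) i (indicator {q ^ p}) t * F t * (t - t / q)) = (\<Sum>k\<in>{r + m..n}. ?h k)"
    unfolding set using assms
    by (subst sum.reindex[OF inj]) (auto intro!: sum.cong simp: rho_nabla_eq power_int_minus
        simp flip: of_nat_mult)
  \<comment> \<open>The shifted derivative can be nonzero only at exponents from
    \<open>r - i + p\<close> to \<open>r + p\<close>; the bounds on \<open>p\<close> place all of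
    these inside the interval.\<close>
  also have "\<dots> = (\<Sum>k\<in>(\<lambda>k. k + (r - i + p)) ` {..i}. ?h k)"
  proof (rule sum.mono_neutral_right)
    show "(\<lambda>k. k + (r - i + p)) ` {..i} \<subseteq> {r + m..n}" using assms by auto
    show "\<forall>k\<in>{r + m..n} - (\<lambda>k. k + (r - i + p)) ` {..i}. ?h k = 0"
    proof
      fix k assume k: "k \<in> {r + m..n} - (\<lambda>k. k + (r - i + p)) ` {..i}"
      have "?g (q powi (- int (r - i)) * q ^ k) = 0"
      proof (rule ccontr)
        assume "?g (q powi (- int (r - i)) * q ^ k) \<noteq> 0"
        then obtain l where l: "l \<le> i" "q powi (- int (r - i)) * q ^ k = q ^ l * q ^ p"
          using nabla_pow_support[of q i "q ^ p"] q by auto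
        then have "q ^ k = q ^ (l + (r - i + p))"
          using q by (simp add: power_int_minus power_add field_simps)
        then have "k = l + (r - i + p)" using q by (rule_tac power_inject_exp[THEN iffD1])
        then show False using k l(1) by auto
      qed
      then show "?h k = 0" by simp
    qed
  qed simp
  also have "\<dots> = (\<Sum>k\<le>i. ?h (k + (r - i + p)))"
    by (subst sum.reindex) (auto intro!: inj_onI)
  \<comment> \<open>The factor \<open>q ^ (r - i)\<close> comes from the integration weight.\<close>
  also have "\<dots> = inverse ?e * q ^ (r - i) * (\<Sum>k\<le>i. F (q ^ (r - i) * (q ^ k * q ^ p)) * ?g (q ^ k * q ^ p)
      * (q ^ k * q ^ p - q ^ k * q ^ p / q))"
    unfolding sum_distrib_left
  proof (rule sum.cong[OF refl])
    fix k
    have "q ^ (k + (r - i + p)) = q ^ (r - i) * (q ^ k * q ^ p)" by (simp add: power_add)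
    moreover have "q powi (- int (r - i)) * (q ^ (r - i) * (q ^ k * q ^ p)) = q ^ k * q ^ p"
      using q by (simp add: power_int_minus)
    ultimately show "?h (k + (r - i + p)) = inverse ?e * q ^ (r - i) *
        (F (q ^ (r - i) * (q ^ k * q ^ p)) * ?g (q ^ k * q ^ p)
          * (q ^ k * q ^ p - q ^ k * q ^ p / q))"
      by (simp only: times_divide_eq_right[symmetric] right_diff_distrib[symmetric]) simp
  qed
  also have "(\<Sum>k\<le>i. F (q ^ (r - i) * (q ^ k * q ^ p)) * ?g (q ^ k * q ^ p)
      * (q ^ k * q ^ p - q ^ k * q ^ p / q))
    = (- 1) ^ i * q ^ (i + i * (i - 1) div 2) * (nabla q ^^ i) (\<lambda>x. F (q ^ (r - i) * x)) (q ^ i * q ^ p)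
        * (q ^ p - q ^ p / q)"
    by (rule summation_by_parts[where F = "\<lambda>x. F (q ^ (r - i) * x)"]) (use q in auto)
  also have "(nabla q ^^ i) (\<lambda>x. F (q ^ (r - i) * x)) (q ^ i * q ^ p)
      = ?e * (nabla q ^^ i) F (q ^ (r - i) * (q ^ i * q ^ p))"
    using q by (subst nabla_pow_scale) (simp_all add: power_mult[symmetric] mult.commute)
  also have "q ^ (r - i) * (q ^ i * q ^ p) = q ^ (r + p)"
    using assms(2) by (simp add: power_add[symmetric])
  \<comment> \<open>The factor \<open>?e\<close> from differentiating the dilated \<open>F\<close>
    cancels the one from \<open>rho_nabla_eq\<close>; the weight's \<open>q ^ (r - i)\<close> and
    the \<open>q ^ i\<close> from summation by parts combine to \<open>q ^ r\<close>.\<close>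
  also have "inverse ?e * q ^ (r - i) * ((- 1) ^ i * q ^ (i + i * (i - 1) div 2)
        * (?e * (nabla q ^^ i) F (q ^ (r + p))) * (q ^ p - q ^ p / q))
      = (q ^ (r - i) * q ^ i) * (q ^ p - q ^ p / q) *
           ((- 1) ^ i * q ^ (i * (i - 1) div 2) * (nabla q ^^ i) F (q ^ (r + p)))"
    using q by (simp add: power_add)
  also have "q ^ (r - i) * q ^ i = q ^ r"
    using assms(2) by (simp add: power_add[symmetric])
  finally show ?thesis .
qed

theorem corollary18:
  fixes q a b :: real and r :: nat
    and L :: "real \<Rightarrow> (nat \<Rightarrow> real) \<Rightarrow> real"
    and \<alpha> \<beta> :: "nat \<Rightarrow> real" and y :: "real \<Rightarrow> real"
  assumes "q > 1" and "r \<ge> 1"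
    and "a \<in> qscale q" and "b \<in> qscale q"
    and "card (qinterval q a b) \<ge> 2 * r + 1"
    and "admissible_lagrangian q r a b L"
    and "weak_local_minimizer q r a b L \<alpha> \<beta> y \<or> weak_local_maximizer q r a b L \<alpha> \<beta> y"
  shows "\<forall>t\<in>qinterval q (q ^ (2 * r) * a) b.
    (\<Sum>i\<le>r. (- 1) ^ i * q ^ (i * (i - 1) div 2) *
       (nabla q ^^ i)
         (\<lambda>s. partial_u L i s
            (\<lambda>j\<in>{..r}. q powi (- int (j * (r - j))) *
               (nabla q ^^ j) y (q powi (- int (r - j)) * s))) t) = 0"
proof
  note q = assms(1)
  let ?F = "\<lambda>i s. partial_u L i s (\<lambda>j\<in>{..r}. q powi (- int (j * (r - j))) *
               (nabla q ^^ j) y (q powi (- int (r - j)) * s))"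
  fix t assume t: "t \<in> qinterval q (q ^ (2 * r) * a) b"
  obtain m n where m: "a = q ^ m" and n: "b = q ^ n" using assms(3,4) by (auto simp: qscale_def)
  have "t \<in> (\<lambda>k. q ^ k) ` {2 * r + m..n}"
    using t qinterval_image[OF q, of "2 * r + m" n] by (simp add: m n power_add)
  then obtain k where k: "t = q ^ k" "2 * r + m \<le> k" "k \<le> n" by auto
  \<comment> \<open>The perturbation sits \<open>r\<close> steps to the left of \<open>t\<close>,
    since the last point of the order-\<open>i\<close> term is \<open>q ^ (r + p)\<close> for every
    \<open>i\<close>.\<close>
  define p where "p = k - r"
  have p: "t = q ^ (r + p)" "m + r \<le> p" "p + r \<le> n" using k by (auto simp: p_def)
  define \<eta> :: "real \<Rightarrow> real" where "\<eta> = indicator {q ^ p}"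
  have set: "qinterval q (q ^ r * a) b = (\<lambda>k. q ^ k) ` {r + m..n}"
    using qinterval_image[OF q, of "r + m" n] by (simp add: m n power_add)
  \<comment> \<open>The left boundary exponent \<open>r - 1 + m\<close> is below \<open>p\<close>,
    and for \<open>i < r\<close> the right one satisfies \<open>p + i < p + r \<le> n\<close>; so
    both boundary conditions follow.\<close>
  have zero: "(nabla q ^^ i) \<eta> (q ^ l) = 0" if "l < p \<or> p + i < l" for i l
  proof (rule ccontr)
    assume "(nabla q ^^ i) \<eta> (q ^ l) \<noteq> 0"
    then obtain h where "h \<le> i" "q ^ l = q ^ (h + p)"
      using nabla_pow_support[of q i "q ^ p" "q ^ l"] q unfolding \<eta>_def by (auto simp: power_add)
    then show False using that q by simp
  qed
  have sig: "(sigma q ^^ l) a = q ^ (l + m)" for l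
    by (induction l) (simp_all add: m sigma_def)
  have "(\<Sum>t\<in>qinterval q (q ^ r * a) b. (\<Sum>i\<le>r. rho_nabla q (r - i) i \<eta> t *
            partial_u L i t (\<lambda>j\<in>{..r}. rho_nabla q (r - j) j y t)) * (t - t / q)) = 0"
  proof (rule first_variation[OF assms(1-4) _ assms(6,7)])
    show "qinterval q (q ^ r * a) b \<noteq> {}" using p unfolding set by simp
    show "(nabla q ^^ i) \<eta> ((sigma q ^^ (r - 1)) a) = 0" if "i < r" for i
      unfolding sig by (rule zero) (use that p in linarith)
    show "(nabla q ^^ i) \<eta> b = 0" if "i < r" for i
      unfolding n by (rule zero) (use that p in linarith)
  qed
  moreover have "(\<lambda>j\<in>{..r}. rho_nabla q (r - j) j y s)
      = (\<lambda>j\<in>{..r}. q powi (- int (j * (r - j))) * (nabla q ^^ j) y (q powi (- int (r - j)) * s))"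
    if "s \<in> qinterval q (q ^ r * a) b" for s
    using that q unfolding set by (auto simp: rho_nabla_eq intro!: restrict_ext)
  ultimately have "0 = (\<Sum>t\<in>qinterval q (q ^ r * a) b. \<Sum>i\<le>r.
      rho_nabla q (r - i) i \<eta> t * ?F i t * (t - t / q))"
    by (simp add: sum_distrib_right cong: sum.cong)
  also have "\<dots> = (\<Sum>i\<le>r. \<Sum>t\<in>qinterval q (q ^ r * a) b.
      rho_nabla q (r - i) i \<eta> t * ?F i t * (t - t / q))"
    by (rule sum.swap)
  also have "\<dots> = (\<Sum>i\<le>r. q ^ r * (q ^ p - q ^ p / q) *
      ((- 1) ^ i * q ^ (i * (i - 1) div 2) * (nabla q ^^ i) (?F i) t))"
    unfolding m n \<eta>_def p(1)
    by (intro sum.cong[OF refl] sum_against_indicator) (use q p in auto)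
  also have "\<dots> = q ^ r * (q ^ p - q ^ p / q) *
      (\<Sum>i\<le>r. (- 1) ^ i * q ^ (i * (i - 1) div 2) * (nabla q ^^ i) (?F i) t)"
    by (rule sum_distrib_left[symmetric])
  \<comment> \<open>The prefactor is positive because \<open>q > 1\<close>, so it cancels.\<close>
  finally show "(\<Sum>i\<le>r. (- 1) ^ i * q ^ (i * (i - 1) div 2) * (nabla q ^^ i) (?F i) t) = 0"
    using q by (auto simp: field_simps)
qed

end
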